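(* Let $X$ be a metric space and let $Y$ be a vector space equipped with a shift invariant metric. Let $\Psi:X\rightrightarrows Y$ be a set-valued mapping and $g:X\to Y$ a single-valued mapping. Suppose that $\Psi$ is set-covering on $X$ with constant $\alpha>0$ and that $g$ is Lipschitz on $X$ with constant $\beta\in[0,\alpha)$. Then the mapping $\Psi+g:X\rightrightarrows Y$, $(\Psi+g)(x)=\Psi(x)+g(x)$, is set-covering on $X$ with constant $\alpha-\beta$.
   Context: Conventions: $\Psi$ is assumed to have nonempty closed values at every point of $X$. A metric $d$ on a vector space $Y$ is shift invariant if $d(y_1+z,y_2+z)=d(y_1,y_2)$ for all $y_1,y_2,z\in Y$. In a metric space, $\mathrm{B}(x,r)$ is the closed ball of center $x$ and radius $r$; $\operatorname{dist}(x,S)=\inf_{z\in S}d(z,x)$; $\mathrm{B}(S,r)=\{x:\operatorname{dist}(x,S)\le r\}$. A set-valued mapping $\Psi:X\rightrightarrows Y$ between metric spaces is set-covering on $X$ with constant $\alpha>0$ if for every $x\in X$ and every $r>0$ there exists $u\in \mathrm{B}(x,r)$ such that $\mathrm{B}(\Psi(x),\alpha r)\subseteq\Psi(u)$. *)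

theory Defs
  imports "HOL-Analysis.Analysis"
begin

text \<open>The closed enlargement \<open>B(S, r)\<close>. The library sets \<open>infdist x {} = 0\<close> rather than
  \<open>\<infinity>\<close>, so this agrees with the usual convention only for nonempty \<open>S\<close>.\<close>

definition set_cball :: "'a::metric_space set \<Rightarrow> real \<Rightarrow> 'a set" where
  "set_cball S r = {x. infdist x S \<le> r}"

definition set_covering ::
    "real \<Rightarrow> ('a::metric_space \<Rightarrow> 'b::metric_space set) \<Rightarrow> bool" where
  "set_covering \<alpha> \<Psi> \<longleftrightarrow>
     0 < \<alpha> \<and> (\<forall>x. \<forall>r>0. \<exists>u\<in>cball x r. set_cball (\<Psi> x) (\<alpha> * r) \<subseteq> \<Psi> u)"

definition shift_invariant :: "('b::ab_group_add \<Rightarrow> 'b \<Rightarrow> real) \<Rightarrow> bool" where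
  "shift_invariant d \<longleftrightarrow> (\<forall>y1 y2 z. d (y1 + z) (y2 + z) = d y1 y2)"

end

theory Submission
  imports Defs
begin

text \<open>Given \<open>x\<close> and \<open>r > 0\<close>, the point \<open>u\<close> that set-covering of \<open>\<Psi>\<close> provides also works for
  \<open>\<Psi> + g\<close>. If \<open>y\<close> is within \<open>(\<alpha> - \<beta>) r\<close> of \<open>\<Psi> x + g x\<close>, then by shift invariance
  \<open>y - g x\<close> is within \<open>(\<alpha> - \<beta>) r\<close> of \<open>\<Psi> x\<close>. Replacing \<open>g x\<close> by \<open>g u\<close> moves this
  point by \<open>dist (g x) (g u) \<le> \<beta> r\<close>, so \<open>y - g u\<close> is within \<open>\<alpha> r\<close> of \<open>\<Psi> x\<close> and hence
  belongs to \<open>\<Psi> u\<close>.\<close>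

lemma shift_invariant_dist_diff_left:
  fixes a b y :: "'b::{ab_group_add, metric_space}"
  assumes "shift_invariant (dist :: 'b \<Rightarrow> 'b \<Rightarrow> real)"
  shows "dist (y - a) (y - b) = dist a b"
proof -
  have "dist (y - a + (a + b - y)) (y - b + (a + b - y)) = dist (y - a) (y - b)"
    using assms unfolding shift_invariant_def by blast
  then show ?thesis
    by (simp add: algebra_simps dist_commute)
qed

lemma shift_invariant_infdist_translate:
  fixes y c :: "'b::{ab_group_add, metric_space}"
  assumes "shift_invariant (dist :: 'b \<Rightarrow> 'b \<Rightarrow> real)"
  shows "infdist y ((\<lambda>s. s + c) ` S) = infdist (y - c) S"
proof -
  have "dist y (s + c) = dist (y - c) s" for s
    using assms unfolding shift_invariant_def by (metis diff_add_cancel)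
  then show ?thesis
    by (simp add: infdist_def image_image)
qed

theorem proposition2p13:
  fixes scale :: "'k::field \<Rightarrow> 'y \<Rightarrow> 'y::{ab_group_add, metric_space}"
    and \<Psi> :: "'x::metric_space \<Rightarrow> 'y set"
    and g :: "'x \<Rightarrow> 'y"
    and \<alpha> \<beta> :: real
  assumes "vector_space scale"
    and "shift_invariant (dist :: 'y \<Rightarrow> 'y \<Rightarrow> real)"
    and "\<And>x. \<Psi> x \<noteq> {}"
    and "\<And>x. closed (\<Psi> x)"
    and "set_covering \<alpha> \<Psi>"
    and "0 \<le> \<beta>" and "\<beta> < \<alpha>"
    and "\<beta>-lipschitz_on UNIV g"
  shows "set_covering (\<alpha> - \<beta>) (\<lambda>x. {y + g x | y. y \<in> \<Psi> x})"
proof -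
  have image_eq: "{y + g x | y. y \<in> \<Psi> x} = (\<lambda>y. y + g x) ` \<Psi> x" for x
    by auto
  have "\<exists>u\<in>cball x r. set_cball ((\<lambda>y. y + g x) ` \<Psi> x) ((\<alpha> - \<beta>) * r) \<subseteq> (\<lambda>y. y + g u) ` \<Psi> u"
    if r_pos: "r > 0" for x r
  proof -
    obtain u where u: "u \<in> cball x r" and cover: "set_cball (\<Psi> x) (\<alpha> * r) \<subseteq> \<Psi> u"
      using assms(5) r_pos unfolding set_covering_def by blast
    have "y \<in> (\<lambda>y. y + g u) ` \<Psi> u"
      if "y \<in> set_cball ((\<lambda>y. y + g x) ` \<Psi> x) ((\<alpha> - \<beta>) * r)" for y
    proof -
      have near: "infdist (y - g x) (\<Psi> x) \<le> (\<alpha> - \<beta>) * r"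
        using that by (simp add: set_cball_def shift_invariant_infdist_translate[OF assms(2)])
      have "dist (y - g u) (y - g x) = dist (g u) (g x)"
        by (rule shift_invariant_dist_diff_left[OF assms(2)])
      also have "\<dots> \<le> \<beta> * dist u x"
        using lipschitz_onD[OF assms(8)] by simp
      also have "\<dots> \<le> \<beta> * r"
        using u assms(6) by (simp add: mult_left_mono dist_commute)
      finally have "infdist (y - g u) (\<Psi> x) \<le> (\<alpha> - \<beta>) * r + \<beta> * r"
        using near infdist_triangle[of "y - g u" "\<Psi> x" "y - g x"] by linarith
      then have "y - g u \<in> \<Psi> u"
        using cover by (auto simp: set_cball_def algebra_simps)
      then show ?thesis
        by (rule rev_image_eqI) simp
    qed
    then show ?thesis
      using u by blast
  qed
  then show ?thesis
    using assms(7) unfolding set_covering_def image_eq by simp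
qed

end
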